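(* Every typable $\lambda\mu$-term is weakly normalizable for $\beta\mu\mu'\rho\varepsilon\theta$-reduction: if $M\in\mathcal{T}_t$, then $M\in\mathcal{WN}_{\beta\mu\mu'\rho\varepsilon\theta}$.
   Context: $\lambda\mu$-terms: $\mathcal{T} ::= x \mid \lambda x.\mathcal{T} \mid (\mathcal{T})\mathcal{T} \mid [\alpha]\mathcal{T} \mid \mu\alpha.\mathcal{T}$ ($x$ $\lambda$-variables, $\alpha$ $\mu$-variables), up to renaming of bound variables; substitutions avoid capture. Types: $A ::= X \mid \bot \mid A\to B$. Typing judgments $\Gamma\vdash M:A;\Theta$ derived by: $\Gamma,x:A\vdash x:A;\Theta$; from $\Gamma,x:A\vdash M:B;\Theta$ infer $\Gamma\vdash\lambda x.M:A\to B;\Theta$; from $\Gamma\vdash M:A\to B;\Theta$ and $\Gamma\vdash N:A;\Theta$ infer $\Gamma\vdash(M)N:B;\Theta$; from $\Gamma\vdash M:A;\alpha:A,\Theta$ infer $\Gamma\vdash[\alpha]M:\bot;\alpha:A,\Theta$; from $\Gamma\vdash M:\bot;\alpha:A,\Theta$ infer $\Gamma\vdash\mu\alpha.M:A;\Theta$. $\mathcal{T}_t$ = typable terms. $M[x:=N]$ usual substitution; $M[\alpha:=\beta]$ renames free $\alpha$ to $\beta$; $M[\alpha:=_rN]$ (resp. $M[\alpha:=_lN]$) replaces inductively every subterm $[\alpha]P$ by $[\alpha](P')N$ (resp. $[\alpha](N)P'$), $P'$ the substituted $P$; $M_\alpha$ replaces inductively every subterm $[\alpha]P$ by $P$. Rules: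 $\beta$: $(\lambda x.M)N\to M[x:=N]$; $\mu$: $(\mu\alpha.M)N\to\mu\alpha.M[\alpha:=_rN]$; $\mu'$: $(N)\mu\alpha.M\to\mu\alpha.M[\alpha:=_lN]$; $\rho$: $[\beta]\mu\alpha.M\to M[\alpha:=\beta]$; $\theta$: $\mu\alpha.[\alpha]M\to M$ if $\alpha$ not free in $M$; $\varepsilon$: $\mu\alpha.\mu\beta.M\to\mu\alpha.M_\beta$. One-step reduction contracts one redex anywhere; $\mathcal{WN}_{\mathcal{R}}$ is the set of terms that reduce in finitely many steps to a term containing no redex of the rules in $\mathcal{R}$. *)

theory Defs
  imports Main
begin

text \<open>
  Lambda-mu terms up to renaming of bound variables are represented with de Bruijn indices.
  There are two independent index spaces: \<open>Lam\<close> binds the \<open>\<lambda>\<close>-index 0 only, \<open>Mu\<close> binds the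
  \<open>\<mu>\<close>-index 0 only. \<open>Name a M\<close> stands for \<open>[a]M\<close>.
\<close>

datatype trm =
    Var nat
  | Lam trm
  | App trm trm
  | Name nat trm
  | Mu trm

datatype type =
    TVar nat
  | Bot
  | Arr type type  (infixr "\<rightarrow>" 65)

text \<open>Both contexts are finite lists, position \<open>i\<close> giving the type of the variable with index \<open>i\<close>.\<close>

inductive typing :: "type list \<Rightarrow> trm \<Rightarrow> type \<Rightarrow> type list \<Rightarrow> bool"
  ("_ \<turnstile> _ \<^bold>: _ \<^bold>; _" [50, 50, 50, 50] 50)
where
  ty_Var: "i < length \<Gamma> \<Longrightarrow> \<Gamma> ! i = A \<Longrightarrow> \<Gamma> \<turnstile> Var i \<^bold>: A \<^bold>; \<Theta>"
| ty_Lam: "A # \<Gamma> \<turnstile> M \<^bold>: B \<^bold>; \<Theta> \<Longrightarrow> \<Gamma> \<turnstile> Lam M \<^bold>: A \<rightarrow> B \<^bold>; \<Theta>"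
| ty_App: "\<Gamma> \<turnstile> M \<^bold>: A \<rightarrow> B \<^bold>; \<Theta> \<Longrightarrow> \<Gamma> \<turnstile> N \<^bold>: A \<^bold>; \<Theta> \<Longrightarrow> \<Gamma> \<turnstile> App M N \<^bold>: B \<^bold>; \<Theta>"
| ty_Name: "a < length \<Theta> \<Longrightarrow> \<Theta> ! a = A \<Longrightarrow> \<Gamma> \<turnstile> M \<^bold>: A \<^bold>; \<Theta> \<Longrightarrow> \<Gamma> \<turnstile> Name a M \<^bold>: Bot \<^bold>; \<Theta>"
| ty_Mu: "\<Gamma> \<turnstile> M \<^bold>: Bot \<^bold>; A # \<Theta> \<Longrightarrow> \<Gamma> \<turnstile> Mu M \<^bold>: A \<^bold>; \<Theta>"

definition typable :: "trm set" where
  "typable = {M. \<exists>\<Gamma> A \<Theta>. \<Gamma> \<turnstile> M \<^bold>: A \<^bold>; \<Theta>}"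

primrec liftL :: "nat \<Rightarrow> trm \<Rightarrow> trm" where
  "liftL k (Var i) = Var (if i < k then i else Suc i)"
| "liftL k (Lam M) = Lam (liftL (Suc k) M)"
| "liftL k (App M N) = App (liftL k M) (liftL k N)"
| "liftL k (Name a M) = Name a (liftL k M)"
| "liftL k (Mu M) = Mu (liftL k M)"

primrec liftM :: "nat \<Rightarrow> trm \<Rightarrow> trm" where
  "liftM k (Var i) = Var i"
| "liftM k (Lam M) = Lam (liftM k M)"
| "liftM k (App M N) = App (liftM k M) (liftM k N)"
| "liftM k (Name a M) = Name (if a < k then a else Suc a) (liftM k M)"
| "liftM k (Mu M) = Mu (liftM (Suc k) M)"

text \<open>\<open>subst M k N\<close> is \<open>M[x:=N]\<close> for the \<open>\<lambda>\<close>-variable \<open>x\<close> with index \<open>k\<close>; as the binder of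
  \<open>x\<close> is removed, larger \<open>\<lambda>\<close>-indices are decremented.\<close>

primrec subst :: "trm \<Rightarrow> nat \<Rightarrow> trm \<Rightarrow> trm" where
  "subst (Var i) k N = (if i < k then Var i else if i = k then N else Var (i - 1))"
| "subst (Lam M) k N = Lam (subst M (Suc k) (liftL 0 N))"
| "subst (App M P) k N = App (subst M k N) (subst P k N)"
| "subst (Name a M) k N = Name a (subst M k N)"
| "subst (Mu M) k N = Mu (subst M k (liftM 0 N))"

text \<open>\<open>substR M a N\<close> is \<open>M[a:=\<^sub>r N]\<close> and \<open>substL M a N\<close> is \<open>M[a:=\<^sub>l N]\<close>. The variable \<open>a\<close>
  stays in scope, so no index is decremented.\<close>

primrec substR :: "trm \<Rightarrow> nat \<Rightarrow> trm \<Rightarrow> trm" where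
  "substR (Var i) a N = Var i"
| "substR (Lam M) a N = Lam (substR M a (liftL 0 N))"
| "substR (App M P) a N = App (substR M a N) (substR P a N)"
| "substR (Name b M) a N =
     (if b = a then Name a (App (substR M a N) N) else Name b (substR M a N))"
| "substR (Mu M) a N = Mu (substR M (Suc a) (liftM 0 N))"

primrec substL :: "trm \<Rightarrow> nat \<Rightarrow> trm \<Rightarrow> trm" where
  "substL (Var i) a N = Var i"
| "substL (Lam M) a N = Lam (substL M a (liftL 0 N))"
| "substL (App M P) a N = App (substL M a N) (substL P a N)"
| "substL (Name b M) a N =
     (if b = a then Name a (App N (substL M a N)) else Name b (substL M a N))"
| "substL (Mu M) a N = Mu (substL M (Suc a) (liftM 0 N))"

text \<open>\<open>rename M a b\<close> is \<open>M[a:=b]\<close>, the binder of \<open>a\<close> being removed; \<open>b\<close> is an index in the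
  scope without \<open>a\<close>.\<close>

primrec rename :: "trm \<Rightarrow> nat \<Rightarrow> nat \<Rightarrow> trm" where
  "rename (Var i) a b = Var i"
| "rename (Lam M) a b = Lam (rename M a b)"
| "rename (App M P) a b = App (rename M a b) (rename P a b)"
| "rename (Name c M) a b =
     Name (if c < a then c else if c = a then b else c - 1) (rename M a b)"
| "rename (Mu M) a b = Mu (rename M (Suc a) (Suc b))"

text \<open>\<open>erase M a\<close> is \<open>M\<^sub>a\<close>: every \<open>[a]P\<close> becomes \<open>P\<close>, and the binder of \<open>a\<close> is removed.\<close>

primrec erase :: "trm \<Rightarrow> nat \<Rightarrow> trm" where
  "erase (Var i) a = Var i"
| "erase (Lam M) a = Lam (erase M a)"
| "erase (App M P) a = App (erase M a) (erase P a)"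
| "erase (Name c M) a =
     (if c = a then erase M a else Name (if c < a then c else c - 1) (erase M a))"
| "erase (Mu M) a = Mu (erase M (Suc a))"

primrec freeM :: "nat \<Rightarrow> trm \<Rightarrow> bool" where
  "freeM a (Var i) = False"
| "freeM a (Lam M) = freeM a M"
| "freeM a (App M P) = (freeM a M \<or> freeM a P)"
| "freeM a (Name c M) = (c = a \<or> freeM a M)"
| "freeM a (Mu M) = freeM (Suc a) M"

text \<open>\<open>lowerM a M\<close> removes the binder of a \<open>\<mu>\<close>-variable \<open>a\<close> that is not free in \<open>M\<close>; it
  undoes \<open>liftM a\<close>.\<close>

primrec lowerM :: "nat \<Rightarrow> trm \<Rightarrow> trm" where
  "lowerM a (Var i) = Var i"
| "lowerM a (Lam M) = Lam (lowerM a M)"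
| "lowerM a (App M P) = App (lowerM a M) (lowerM a P)"
| "lowerM a (Name c M) = Name (if c > a then c - 1 else c) (lowerM a M)"
| "lowerM a (Mu M) = Mu (lowerM (Suc a) M)"

lemma lowerM_liftM: "lowerM a (liftM a M) = M"
  by (induction M arbitrary: a) auto

lemma liftM_lowerM: "\<not> freeM a M \<Longrightarrow> liftM a (lowerM a M) = M"
  by (induction M arbitrary: a) auto

datatype rule = Beta | MuRule | MuPrime | Rho | Theta | Epsilon

text \<open>\<open>contract r P Q\<close>: \<open>P\<close> is an \<open>r\<close>-redex with contractum \<open>Q\<close>. In the rule \<open>Epsilon\<close>, the
  inner variable has index 0 in \<open>M\<close> and the outer one index 1.\<close>

inductive contract :: "rule \<Rightarrow> trm \<Rightarrow> trm \<Rightarrow> bool" where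
  "contract Beta (App (Lam M) N) (subst M 0 N)"
| "contract MuRule (App (Mu M) N) (Mu (substR M 0 (liftM 0 N)))"
| "contract MuPrime (App N (Mu M)) (Mu (substL M 0 (liftM 0 N)))"
| "contract Rho (Name b (Mu M)) (rename M 0 b)"
| "\<not> freeM 0 M \<Longrightarrow> contract Theta (Mu (Name 0 M)) (lowerM 0 M)"
| "contract Epsilon (Mu (Mu M)) (Mu (erase M 0))"

inductive step :: "rule set \<Rightarrow> trm \<Rightarrow> trm \<Rightarrow> bool" for R :: "rule set" where
  step_redex: "r \<in> R \<Longrightarrow> contract r M N \<Longrightarrow> step R M N"
| step_Lam: "step R M N \<Longrightarrow> step R (Lam M) (Lam N)"
| step_AppL: "step R M N \<Longrightarrow> step R (App M P) (App N P)"
| step_AppR: "step R M N \<Longrightarrow> step R (App P M) (App P N)"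
| step_Name: "step R M N \<Longrightarrow> step R (Name a M) (Name a N)"
| step_Mu: "step R M N \<Longrightarrow> step R (Mu M) (Mu N)"

primrec subterms :: "trm \<Rightarrow> trm set" where
  "subterms (Var i) = {Var i}"
| "subterms (Lam M) = insert (Lam M) (subterms M)"
| "subterms (App M N) = insert (App M N) (subterms M \<union> subterms N)"
| "subterms (Name a M) = insert (Name a M) (subterms M)"
| "subterms (Mu M) = insert (Mu M) (subterms M)"

definition normal :: "rule set \<Rightarrow> trm \<Rightarrow> bool" where
  "normal R M \<longleftrightarrow> \<not> (\<exists>P \<in> subterms M. \<exists>r \<in> R. \<exists>Q. contract r P Q)"

lemma subterms_self: "M \<in> subterms M"
  by (cases M) auto

lemma normal_iff_no_step: "normal R M \<longleftrightarrow> \<not> (\<exists>N. step R M N)"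
proof -
  have "\<exists>P \<in> subterms M. \<exists>r \<in> R. \<exists>Q. contract r P Q" if "step R M N" for N
    using that by (induction rule: step.induct) (use subterms_self in \<open>fastforce+\<close>)
  moreover have "\<exists>N. step R M N" if "P \<in> subterms M" "r \<in> R" "contract r P Q" for P r Q
    using that by (induction M) (auto intro: step.intros)
  ultimately show ?thesis
    unfolding normal_def by blast
qed

definition WN :: "rule set \<Rightarrow> trm set" where
  "WN R = {M. \<exists>N. (step R)\<^sup>*\<^sup>* M N \<and> normal R N}"

end

theory Submission
  imports Defs
begin

text \<open>
  The rule \<open>\<theta>\<close> is postponed: in a term normal for the other rules, \<open>\<mu>\<close> occurs only at the
  root or directly below a \<open>\<lambda>\<close>, so contracting an innermost \<open>\<theta>\<close>-redex creates no new redex.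

  For the other rules, the crux is that a substitution \<open>M[x:=N]\<close> of normal terms is normalizable,
  by induction on the size of the type \<open>A\<close> of \<open>x\<close>. An application \<open>P Q\<close> inside \<open>M\<close> whose head is
  \<open>x\<close> has an argument type smaller than \<open>A\<close>, and normalizing it after the substitution fires
  \<open>\<beta>\<close>-redexes of that argument type only: the rules \<open>\<mu>\<close> and \<open>\<mu>'\<close> merely distribute the application
  over the named subterms, which are never \<open>\<mu>\<close>-abstractions in a normal term, and any \<open>\<mu>\<close> that
  appears below a name is removed by \<open>\<rho>\<close>. If the head is not \<open>x\<close>, the type of the argument is not
  controlled, but then no \<open>\<beta>\<close>-redex arises at all.
\<close>

section \<open>Typing of the substitutions and subject reduction\<close>

inductive_cases typing_VarE: "\<Gamma> \<turnstile> Var i \<^bold>: T \<^bold>; \<Theta>"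
inductive_cases typing_LamE: "\<Gamma> \<turnstile> Lam M \<^bold>: T \<^bold>; \<Theta>"
inductive_cases typing_AppE: "\<Gamma> \<turnstile> App M N \<^bold>: T \<^bold>; \<Theta>"
inductive_cases typing_NameE: "\<Gamma> \<turnstile> Name a M \<^bold>: T \<^bold>; \<Theta>"
inductive_cases typing_MuE: "\<Gamma> \<turnstile> Mu M \<^bold>: T \<^bold>; \<Theta>"

lemmas typingE = typing_VarE typing_LamE typing_AppE typing_NameE typing_MuE

lemma typing_liftL:
  "\<Gamma>1 @ \<Gamma>2 \<turnstile> M \<^bold>: T \<^bold>; \<Theta> \<Longrightarrow> \<Gamma>1 @ A # \<Gamma>2 \<turnstile> liftL (length \<Gamma>1) M \<^bold>: T \<^bold>; \<Theta>"
proof (induction M arbitrary: \<Gamma>1 T \<Theta>)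
  case (Var i)
  then show ?case by (auto elim!: typing_VarE intro!: ty_Var simp: nth_append)
next
  case (Lam M)
  from Lam.prems show ?case
    by (auto elim!: typing_LamE intro!: ty_Lam Lam.IH[of "_ # \<Gamma>1", simplified])
next
  case (App M1 M2)
  from App.prems show ?case by (auto elim!: typing_AppE intro: ty_App App.IH)
next
  case (Name a M)
  from Name.prems show ?case by (auto elim!: typing_NameE intro!: ty_Name Name.IH)
next
  case (Mu M)
  from Mu.prems show ?case by (auto elim!: typing_MuE intro!: ty_Mu Mu.IH)
qed

lemma typing_liftL_0: "\<Gamma> \<turnstile> M \<^bold>: T \<^bold>; \<Theta> \<Longrightarrow> A # \<Gamma> \<turnstile> liftL 0 M \<^bold>: T \<^bold>; \<Theta>"
  using typing_liftL[of "[]"] by simp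

lemma typing_liftM:
  "\<Gamma> \<turnstile> M \<^bold>: T \<^bold>; \<Theta>1 @ \<Theta>2 \<Longrightarrow> \<Gamma> \<turnstile> liftM (length \<Theta>1) M \<^bold>: T \<^bold>; \<Theta>1 @ A # \<Theta>2"
proof (induction M arbitrary: \<Gamma> T \<Theta>1)
  case (Var i)
  then show ?case by (auto elim!: typing_VarE intro!: ty_Var)
next
  case (Lam M)
  from Lam.prems show ?case by (auto elim!: typing_LamE intro!: ty_Lam Lam.IH)
next
  case (App M1 M2)
  from App.prems show ?case by (auto elim!: typing_AppE intro: ty_App App.IH)
next
  case (Name a M)
  from Name.prems show ?case by (auto elim!: typing_NameE intro!: ty_Name Name.IH simp: nth_append)
next
  case (Mu M)
  from Mu.prems show ?case
    by (auto elim!: typing_MuE intro!: ty_Mu Mu.IH[of _ _ "_ # \<Theta>1", simplified])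
qed

lemma typing_liftM_0: "\<Gamma> \<turnstile> M \<^bold>: T \<^bold>; \<Theta> \<Longrightarrow> \<Gamma> \<turnstile> liftM 0 M \<^bold>: T \<^bold>; A # \<Theta>"
  using typing_liftM[of _ _ _ "[]"] by simp

lemma typing_subst:
  "\<Gamma>1 @ A # \<Gamma>2 \<turnstile> M \<^bold>: T \<^bold>; \<Theta> \<Longrightarrow> \<Gamma>1 @ \<Gamma>2 \<turnstile> N \<^bold>: A \<^bold>; \<Theta> \<Longrightarrow>
    \<Gamma>1 @ \<Gamma>2 \<turnstile> subst M (length \<Gamma>1) N \<^bold>: T \<^bold>; \<Theta>"
proof (induction M arbitrary: \<Gamma>1 T \<Theta> N)
  case (Var i)
  then show ?case by (auto elim!: typing_VarE intro!: ty_Var simp: nth_append nth_Cons')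
next
  case (Lam M)
  from Lam.prems show ?case
    by (auto elim!: typing_LamE intro!: ty_Lam typing_liftL_0 Lam.IH[of "_ # \<Gamma>1", simplified])
next
  case (App M1 M2)
  from App.prems show ?case by (auto elim!: typing_AppE intro: ty_App App.IH)
next
  case (Name a M)
  from Name.prems show ?case by (auto elim!: typing_NameE intro!: ty_Name Name.IH)
next
  case (Mu M)
  from Mu.prems show ?case by (auto elim!: typing_MuE intro!: ty_Mu typing_liftM_0 Mu.IH)
qed

text \<open>The variable \<open>a\<close> stays in scope while its type drops from
  \<open>A \<rightarrow> B\<close> to \<open>B\<close>, whence the list update. Copies of
  \<open>N\<close> end up in the result, so \<open>N\<close> is typed in the updated
  context.\<close>

lemma typing_substR:
  "\<Gamma> \<turnstile> M \<^bold>: T \<^bold>; \<Theta> \<Longrightarrow> a < length \<Theta> \<Longrightarrow> \<Theta> ! a = A \<rightarrow> B \<Longrightarrow> \<Gamma> \<turnstile> N \<^bold>: A \<^bold>; \<Theta>[a := B] \<Longrightarrow>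
    \<Gamma> \<turnstile> substR M a N \<^bold>: T \<^bold>; \<Theta>[a := B]"
proof (induction M arbitrary: \<Gamma> T \<Theta> a N)
  case (Var i)
  then show ?case by (auto elim!: typing_VarE intro!: ty_Var)
next
  case (Lam M)
  from Lam.prems show ?case by (auto elim!: typing_LamE intro!: ty_Lam typing_liftL_0 Lam.IH)
next
  case (App M1 M2)
  from App.prems show ?case by (auto elim!: typing_AppE intro: ty_App App.IH)
next
  case (Name b M)
  have M: "\<Gamma> \<turnstile> M \<^bold>: \<Theta> ! b \<^bold>; \<Theta>" and b: "b < length \<Theta>" "T = Bot"
    using Name.prems(1) by (auto elim: typing_NameE)
  from Name.IH[OF M Name.prems(2-4)] show ?case
    using Name.prems(2-4) b by (auto intro!: ty_Name intro: ty_App)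
next
  case (Mu M)
  from Mu.prems show ?case
    by (auto elim!: typing_MuE intro!: ty_Mu typing_liftM_0 Mu.IH[of _ _ "_ # \<Theta>" "Suc a", simplified])
qed

lemma typing_substL:
  "\<Gamma> \<turnstile> M \<^bold>: T \<^bold>; \<Theta> \<Longrightarrow> a < length \<Theta> \<Longrightarrow> \<Theta> ! a = A \<Longrightarrow> \<Gamma> \<turnstile> N \<^bold>: A \<rightarrow> B \<^bold>; \<Theta>[a := B] \<Longrightarrow>
    \<Gamma> \<turnstile> substL M a N \<^bold>: T \<^bold>; \<Theta>[a := B]"
proof (induction M arbitrary: \<Gamma> T \<Theta> a N)
  case (Var i)
  then show ?case by (auto elim!: typing_VarE intro!: ty_Var)
next
  case (Lam M)
  from Lam.prems show ?case by (auto elim!: typing_LamE intro!: ty_Lam typing_liftL_0 Lam.IH)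
next
  case (App M1 M2)
  from App.prems show ?case by (auto elim!: typing_AppE intro: ty_App App.IH)
next
  case (Name b M)
  have M: "\<Gamma> \<turnstile> M \<^bold>: \<Theta> ! b \<^bold>; \<Theta>" and b: "b < length \<Theta>" "T = Bot"
    using Name.prems(1) by (auto elim: typing_NameE)
  from Name.IH[OF M Name.prems(2-4)] show ?case
    using Name.prems(2-4) b by (auto intro!: ty_Name intro: ty_App)
next
  case (Mu M)
  from Mu.prems show ?case
    by (auto elim!: typing_MuE intro!: ty_Mu typing_liftM_0 Mu.IH[of _ _ "_ # \<Theta>" "Suc a", simplified])
qed

lemma typing_rename:
  "\<Gamma> \<turnstile> M \<^bold>: T \<^bold>; \<Theta>1 @ A # \<Theta>2 \<Longrightarrow> b < length (\<Theta>1 @ \<Theta>2) \<Longrightarrow> (\<Theta>1 @ \<Theta>2) ! b = A \<Longrightarrow>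
    \<Gamma> \<turnstile> rename M (length \<Theta>1) b \<^bold>: T \<^bold>; \<Theta>1 @ \<Theta>2"
proof (induction M arbitrary: \<Gamma> T \<Theta>1 b)
  case (Var i)
  then show ?case by (auto elim!: typing_VarE intro!: ty_Var)
next
  case (Lam M)
  from Lam.prems show ?case by (auto elim!: typing_LamE intro!: ty_Lam Lam.IH)
next
  case (App M1 M2)
  from App.prems(1) show ?case
    by (auto elim!: typing_AppE simp del: append_assoc
      intro: ty_App App.IH[OF _ App.prems(2,3)])
next
  case (Name c M)
  from Name.prems show ?case by (auto elim!: typing_NameE intro!: ty_Name Name.IH simp: nth_append nth_Cons')
next
  case (Mu M)
  from Mu.prems show ?case
    by (auto elim!: typing_MuE intro!: ty_Mu Mu.IH[of _ _ "_ # \<Theta>1" "Suc b", simplified])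
qed

text \<open>Replacing \<open>[a]P\<close> by \<open>P\<close> keeps the type because
  \<open>a\<close>, and hence \<open>P\<close>, has type \<open>Bot\<close>. This is the situation
  of \<epsilon>: the inner \<mu> is the body of the outer one, so its variable has type
  \<open>Bot\<close>.\<close>

lemma typing_erase:
  "\<Gamma> \<turnstile> M \<^bold>: T \<^bold>; \<Theta>1 @ Bot # \<Theta>2 \<Longrightarrow> \<Gamma> \<turnstile> erase M (length \<Theta>1) \<^bold>: T \<^bold>; \<Theta>1 @ \<Theta>2"
proof (induction M arbitrary: \<Gamma> T \<Theta>1)
  case (Var i)
  then show ?case by (auto elim!: typing_VarE intro!: ty_Var)
next
  case (Lam M)
  from Lam.prems show ?case by (auto elim!: typing_LamE intro!: ty_Lam Lam.IH)
next
  case (App M1 M2)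
  from App.prems show ?case by (auto elim!: typing_AppE intro: ty_App App.IH)
next
  case (Name c M)
  from Name.prems show ?case by (auto elim!: typing_NameE intro!: ty_Name Name.IH simp: nth_append nth_Cons')
next
  case (Mu M)
  from Mu.prems show ?case
    by (auto elim!: typing_MuE intro!: ty_Mu Mu.IH[of _ _ "_ # \<Theta>1", simplified])
qed

abbreviation core :: "rule set" where
  "core \<equiv> {Beta, MuRule, MuPrime, Rho, Epsilon}"

lemma contract_typing:
  assumes "contract r M N" "r \<in> core" "\<Gamma> \<turnstile> M \<^bold>: T \<^bold>; \<Theta>"
  shows "\<Gamma> \<turnstile> N \<^bold>: T \<^bold>; \<Theta>"
  using assms
proof cases
  case (1 P Q)
  then show ?thesis using assms(3) typing_subst[of "[]"] by (auto elim!: typingE)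
next
  case (2 P Q)
  then obtain A where "\<Gamma> \<turnstile> P \<^bold>: Bot \<^bold>; (A \<rightarrow> T) # \<Theta>" "\<Gamma> \<turnstile> Q \<^bold>: A \<^bold>; \<Theta>"
    using assms(3) by (auto elim!: typingE)
  then show ?thesis
    using 2 typing_substR[of \<Gamma> P Bot "(A \<rightarrow> T) # \<Theta>" 0 A T "liftM 0 Q"]
    by (auto intro: ty_Mu typing_liftM_0)
next
  case (3 Q P)
  then obtain A where "\<Gamma> \<turnstile> P \<^bold>: Bot \<^bold>; A # \<Theta>" "\<Gamma> \<turnstile> Q \<^bold>: A \<rightarrow> T \<^bold>; \<Theta>"
    using assms(3) by (auto elim!: typingE)
  then show ?thesis
    using 3 typing_substL[of \<Gamma> P Bot "A # \<Theta>" 0 A "liftM 0 Q" T]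
    by (auto intro: ty_Mu typing_liftM_0)
next
  case (4 b P)
  then show ?thesis using assms(3) typing_rename[of _ _ _ "[]"] by (auto elim!: typingE)
next
  case (5 P)
  then show ?thesis using assms(2) by simp
next
  case (6 P)
  then show ?thesis using assms(3) typing_erase[of _ _ _ "[]"] by (auto elim!: typingE intro!: ty_Mu)
qed

lemma step_typing:
  "step core M N \<Longrightarrow> \<Gamma> \<turnstile> M \<^bold>: T \<^bold>; \<Theta> \<Longrightarrow> \<Gamma> \<turnstile> N \<^bold>: T \<^bold>; \<Theta>"
proof (induction arbitrary: \<Gamma> T \<Theta> rule: step.induct)
  case (step_redex r M N)
  then show ?case using contract_typing by blast
qed (auto elim!: typingE intro: typing.intros)

section \<open>Core reduction under the term constructors\<close>

abbreviation red :: "trm \<Rightarrow> trm \<Rightarrow> bool"  (infix "\<rightarrow>*" 50) where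
  "red \<equiv> (step core)\<^sup>*\<^sup>*"

lemma red_typing: "M \<rightarrow>* N \<Longrightarrow> \<Gamma> \<turnstile> M \<^bold>: T \<^bold>; \<Theta> \<Longrightarrow> \<Gamma> \<turnstile> N \<^bold>: T \<^bold>; \<Theta>"
  by (induction rule: rtranclp_induct) (auto intro: step_typing)

lemma steps_Lam: "(step R)\<^sup>*\<^sup>* M N \<Longrightarrow> (step R)\<^sup>*\<^sup>* (Lam M) (Lam N)"
  by (induction rule: rtranclp_induct) (auto intro: step_Lam rtranclp.rtrancl_into_rtrancl)

lemma steps_Name: "(step R)\<^sup>*\<^sup>* M N \<Longrightarrow> (step R)\<^sup>*\<^sup>* (Name a M) (Name a N)"
  by (induction rule: rtranclp_induct) (auto intro: step_Name rtranclp.rtrancl_into_rtrancl)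

lemma steps_Mu: "(step R)\<^sup>*\<^sup>* M N \<Longrightarrow> (step R)\<^sup>*\<^sup>* (Mu M) (Mu N)"
  by (induction rule: rtranclp_induct) (auto intro: step_Mu rtranclp.rtrancl_into_rtrancl)

lemma steps_AppL: "(step R)\<^sup>*\<^sup>* M N \<Longrightarrow> (step R)\<^sup>*\<^sup>* (App M P) (App N P)"
  by (induction rule: rtranclp_induct) (auto intro: step_AppL rtranclp.rtrancl_into_rtrancl)

lemma steps_AppR: "(step R)\<^sup>*\<^sup>* M N \<Longrightarrow> (step R)\<^sup>*\<^sup>* (App P M) (App P N)"
  by (induction rule: rtranclp_induct) (auto intro: step_AppR rtranclp.rtrancl_into_rtrancl)

lemma steps_App:
  "(step R)\<^sup>*\<^sup>* M M' \<Longrightarrow> (step R)\<^sup>*\<^sup>* N N' \<Longrightarrow> (step R)\<^sup>*\<^sup>* (App M N) (App M' N')"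
  using steps_AppL steps_AppR by (rule rtranclp_trans)

lemma red_contract: "contract r M N \<Longrightarrow> r \<in> core \<Longrightarrow> N \<rightarrow>* P \<Longrightarrow> M \<rightarrow>* P"
  by (blast intro: converse_rtranclp_into_rtranclp step_redex)

section \<open>Core normal forms, guarded names and inert terms\<close>

fun is_Lam :: "trm \<Rightarrow> bool" where
  "is_Lam (Lam M) = True"
| "is_Lam _ = False"

fun is_Mu :: "trm \<Rightarrow> bool" where
  "is_Mu (Mu M) = True"
| "is_Mu _ = False"

text \<open>Structural form of normality for \<open>core\<close>: the shape conditions exclude
  \<beta>, \<mu> and \<mu>' at an application, \<rho> at a name and \<epsilon> at a \<mu>.\<close>

primrec core_nf :: "trm \<Rightarrow> bool" where
  "core_nf (Var i) = True"
| "core_nf (Lam M) = core_nf M"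
| "core_nf (App M N) = (core_nf M \<and> core_nf N \<and> \<not> is_Lam M \<and> \<not> is_Mu M \<and> \<not> is_Mu N)"
| "core_nf (Name a M) = (core_nf M \<and> \<not> is_Mu M)"
| "core_nf (Mu M) = (core_nf M \<and> \<not> is_Mu M)"

text \<open>Meant for right substitution: \<open>[a]P\<close> turns into \<open>[a](P')N\<close>,
  where \<open>(P')N\<close> is a \<beta>-redex if \<open>P\<close> is an abstraction.\<close>

primrec guarded :: "nat \<Rightarrow> trm \<Rightarrow> bool" where
  "guarded a (Var i) = True"
| "guarded a (Lam M) = guarded a M"
| "guarded a (App M N) = (guarded a M \<and> guarded a N)"
| "guarded a (Name b M) = (guarded a M \<and> (b = a \<longrightarrow> \<not> is_Lam M))"
| "guarded a (Mu M) = guarded (Suc a) M"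

text \<open>Applying an inert term never creates a \<open>\<beta>\<close>-redex, neither directly nor after the
  argument has been moved under the \<open>\<mu>\<close>.\<close>

fun inert :: "trm \<Rightarrow> bool" where
  "inert (Lam M) = False"
| "inert (Mu M) = guarded 0 M"
| "inert _ = True"

lemma inert_not_Mu: "\<not> is_Mu M \<Longrightarrow> inert M \<longleftrightarrow> \<not> is_Lam M"
  by (cases M) auto

lemma inert_not_Lam: "inert M \<Longrightarrow> \<not> is_Lam M"
  by (cases M) auto

lemma Bot_not_Lam: "\<Gamma> \<turnstile> M \<^bold>: Bot \<^bold>; \<Theta> \<Longrightarrow> \<not> is_Lam M"
  by (cases M) (auto elim: typing_LamE)

lemma is_Lam_liftL [simp]: "is_Lam (liftL k M) = is_Lam M"
  by (cases M) auto

lemma is_Mu_liftL [simp]: "is_Mu (liftL k M) = is_Mu M"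
  by (cases M) auto

lemma is_Lam_liftM [simp]: "is_Lam (liftM k M) = is_Lam M"
  by (cases M) auto

lemma is_Mu_liftM [simp]: "is_Mu (liftM k M) = is_Mu M"
  by (cases M) auto

lemma is_Lam_rename [simp]: "is_Lam (rename M a b) = is_Lam M"
  by (cases M) auto

lemma is_Mu_rename [simp]: "is_Mu (rename M a b) = is_Mu M"
  by (cases M) auto

lemma is_Lam_substL [simp]: "is_Lam (substL M a N) = is_Lam M"
  by (cases M) auto

lemma is_Mu_substL [simp]: "is_Mu (substL M a N) = is_Mu M"
  by (cases M) auto

lemma core_nf_liftL [simp]: "core_nf (liftL k M) = core_nf M"
  by (induction M arbitrary: k) auto

lemma core_nf_liftM [simp]: "core_nf (liftM k M) = core_nf M"
  by (induction M arbitrary: k) auto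

lemma core_nf_rename [simp]: "core_nf (rename M a b) = core_nf M"
  by (induction M arbitrary: a b) auto

text \<open>The body \<open>P\<close> of a name \<open>[a]P\<close> in normal \<open>M\<close> is
  not a \<mu>, and an \<open>N\<close> of this shape forms no redex with such an argument.\<close>

lemma core_nf_substL:
  "core_nf M \<Longrightarrow> core_nf N \<Longrightarrow> \<not> is_Lam N \<Longrightarrow> \<not> is_Mu N \<Longrightarrow> core_nf (substL M a N)"
  by (induction M arbitrary: a N) auto

lemma guarded_liftL [simp]: "guarded a (liftL k M) = guarded a M"
  by (induction M arbitrary: a k) auto

lemma guarded_liftM_self: "guarded k (liftM k M)"
  by (induction M arbitrary: k) auto

lemma guarded_liftM: "k \<le> a \<Longrightarrow> guarded (Suc a) (liftM k M) = guarded a M"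
  by (induction M arbitrary: a k) auto

lemma guarded_liftM_0 [simp]: "guarded (Suc a) (liftM 0 M) = guarded a M"
  by (simp add: guarded_liftM)

text \<open>Every name \<open>a\<close> coming from \<open>M\<close> carries an application
  afterwards, so the condition on \<open>M\<close> concerns only the names other than
  \<open>a\<close>.\<close>

lemma guarded_substL:
  "(c \<noteq> a \<Longrightarrow> guarded c M) \<Longrightarrow> guarded c N \<Longrightarrow> guarded c (substL M a N)"
  by (induction M arbitrary: a c N) auto

text \<open>As \<open>k \<le> a\<close>, a name \<open>a\<close> in the result comes either from
  \<open>k\<close> or from \<open>Suc a\<close>, which is \<open>a\<close> counted before the binder
  of \<open>k\<close> is removed.\<close>

lemma guarded_rename:
  "guarded k M \<Longrightarrow> guarded (Suc a) M \<Longrightarrow> k \<le> a \<Longrightarrow> guarded a (rename M k a)"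
  by (induction M arbitrary: k a) auto

text \<open>Typing is needed here: it excludes that a \<open>[a]P\<close> in function position exposes an abstraction.\<close>

lemma core_nf_erase:
  "\<Gamma> \<turnstile> M \<^bold>: T \<^bold>; \<Theta> \<Longrightarrow> a < length \<Theta> \<Longrightarrow> \<Theta> ! a = Bot \<Longrightarrow> core_nf M \<Longrightarrow>
    core_nf (erase M a) \<and> (is_Lam (erase M a) \<longleftrightarrow> is_Lam M) \<and> (is_Mu (erase M a) \<longleftrightarrow> is_Mu M)"
proof (induction M arbitrary: \<Gamma> T \<Theta> a)
  case (Lam M)
  then show ?case by (fastforce elim: typing_LamE)
next
  case (App M1 M2)
  then show ?case by (fastforce elim: typing_AppE)
next
  case (Name c M)
  have M: "\<Gamma> \<turnstile> M \<^bold>: \<Theta> ! c \<^bold>; \<Theta>"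
    using Name.prems(1) by (auto elim: typing_NameE)
  show ?case
    using Name.IH[OF M Name.prems(2,3)] Name.prems M Bot_not_Lam[of \<Gamma> M \<Theta>] by auto
next
  case (Mu M)
  from Mu.prems show ?case
    using Mu.IH[of _ _ "_ # \<Theta>" "Suc a"] by (auto elim!: typing_MuE)
qed auto

section \<open>Normalizing a name or a \<mu> above a normal term\<close>

text \<open>One \<rho>-step is enough, since a normal term has no \<mu> directly below a \<mu>. For
  \<open>M = Mu V\<close>, the premises \<open>guarded a M\<close> and \<open>inert M\<close> say
  that \<open>V\<close> is guarded for the two indices that become \<open>a\<close>.\<close>

lemma Name_normalizes:
  assumes "core_nf M" "\<Gamma> \<turnstile> Name a M \<^bold>: T \<^bold>; \<Theta>"
  shows "\<exists>W. Name a M \<rightarrow>* W \<and> core_nf W \<and> \<not> is_Mu W \<and> \<not> is_Lam W \<and>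
    (guarded a M \<and> inert M \<longrightarrow> guarded a W)"
proof (cases "is_Mu M")
  case False
  then show ?thesis
    using assms by (intro exI[of _ "Name a M"]) (auto dest: inert_not_Lam)
next
  case True
  then obtain V where V: "M = Mu V" by (cases M) auto
  \<comment> \<open>The body of a \<mu> has type \<open>Bot\<close>, so the \<rho>-step exposes no
    abstraction.\<close>
  moreover have "\<not> is_Lam V"
    using assms(2) V by (auto elim!: typingE dest: Bot_not_Lam)
  moreover have "Name a M \<rightarrow>* rename V 0 a"
    using contract.intros(4) unfolding V by (rule red_contract) auto
  ultimately show ?thesis
    using assms(1) by (intro exI[of _ "rename V 0 a"]) (auto intro: guarded_rename)
qed

text \<open>One \<epsilon>-step is enough: the body below the second \<mu> is not a \<mu>, and by
  typing the erasure does not turn it into one.\<close>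

lemma Mu_normalizes:
  assumes "core_nf M" "\<Gamma> \<turnstile> Mu M \<^bold>: T \<^bold>; \<Theta>"
  shows "\<exists>W. Mu M \<rightarrow>* Mu W \<and> core_nf (Mu W)"
proof (cases "is_Mu M")
  case False
  then show ?thesis
    using assms by (intro exI[of _ M]) auto
next
  case True
  then obtain V where V: "M = Mu V" by (cases M) auto
  then have "\<Gamma> \<turnstile> V \<^bold>: Bot \<^bold>; Bot # T # \<Theta>"
    using assms(2) by (auto elim!: typingE)
  from core_nf_erase[OF this, of 0] have "core_nf (Mu (erase V 0))"
    using assms(1) V by auto
  moreover have "Mu M \<rightarrow>* Mu (erase V 0)"
    using contract.intros(6) unfolding V by (rule red_contract) auto
  ultimately show ?thesis by blast
qed

section \<open>Applications of normal terms\<close>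

text \<open>Serves as a hypothesis on a single argument type in the lemmas on applications; the
  induction on the size of types discharges it later.\<close>

definition subst_normalizes :: "type \<Rightarrow> bool" where
  "subst_normalizes A \<longleftrightarrow> (\<forall>\<Gamma> \<Theta> M N T. core_nf M \<longrightarrow> core_nf N \<longrightarrow>
     A # \<Gamma> \<turnstile> M \<^bold>: T \<^bold>; \<Theta> \<longrightarrow> \<Gamma> \<turnstile> N \<^bold>: A \<^bold>; \<Theta> \<longrightarrow> (\<exists>W. subst M 0 N \<rightarrow>* W \<and> core_nf W))"

text \<open>Only \<beta> can apply at the root, and its contractum is a substitution at type
  \<open>A\<close>. If \<open>M\<close> is no abstraction, the application is already
  normal.\<close>

lemma App_not_Mu_normalizes:
  assumes "core_nf M" "core_nf N" "\<Gamma> \<turnstile> M \<^bold>: A \<rightarrow> B \<^bold>; \<Theta>" "\<Gamma> \<turnstile> N \<^bold>: A \<^bold>; \<Theta>"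
    and "\<not> is_Mu M" "\<not> is_Mu N" "subst_normalizes A \<or> \<not> is_Lam M"
  shows "\<exists>W. App M N \<rightarrow>* W \<and> core_nf W"
proof (cases "is_Lam M")
  case True
  then obtain P where P: "M = Lam P" by (cases M) auto
  moreover have "A # \<Gamma> \<turnstile> P \<^bold>: B \<^bold>; \<Theta>"
    using assms(3) P by (auto elim: typing_LamE)
  moreover have "subst_normalizes A"
    using assms(7) True by blast
  ultimately obtain W where "subst P 0 N \<rightarrow>* W" "core_nf W"
    using assms(1,2,4) unfolding subst_normalizes_def by (metis core_nf.simps(2))
  moreover from this(1) have "App M N \<rightarrow>* W"
    using contract.intros(1) unfolding P by (rule red_contract[rotated 2]) simp
  ultimately show ?thesis by blast
next
  case False
  then show ?thesis using assms by (intro exI[of _ "App M N"]) auto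
qed

text \<open>The body of a name in \<open>M\<close> is not a \<mu>, and by the last conjuncts it does
  not become one. Hence an application of \<open>N\<close> created at a name \<open>a\<close> can
  only be a \<beta>-redex with argument type \<open>A\<close>. The same conjuncts keep the
  constructors of \<open>M\<close> around it free of new redexes.\<close>

lemma substL_normalizes:
  assumes "subst_normalizes A"
  shows "core_nf M \<Longrightarrow> core_nf N \<Longrightarrow> \<not> is_Mu N \<Longrightarrow> \<Gamma> \<turnstile> M \<^bold>: T \<^bold>; \<Theta> \<Longrightarrow>
    a < length \<Theta> \<Longrightarrow> \<Theta> ! a = A \<Longrightarrow> \<Gamma> \<turnstile> N \<^bold>: A \<rightarrow> B \<^bold>; \<Theta>[a := B] \<Longrightarrow>
    \<exists>W. substL M a N \<rightarrow>* W \<and> core_nf W \<and> (is_Mu W \<longrightarrow> is_Mu M) \<and> (is_Lam W \<longrightarrow> is_Lam M)"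
proof (induction M arbitrary: N \<Gamma> T \<Theta> a)
  case (Var i)
  then show ?case by auto
next
  case (Lam M)
  obtain C D where "C # \<Gamma> \<turnstile> M \<^bold>: D \<^bold>; \<Theta>"
    using Lam.prems(4) by (auto elim: typing_LamE)
  with Lam.IH[of "liftL 0 N" "C # \<Gamma>" D \<Theta> a] Lam.prems
  obtain W where "substL M a (liftL 0 N) \<rightarrow>* W" "core_nf W"
    by (auto simp: typing_liftL_0)
  then show ?case by (intro exI[of _ "Lam W"]) (auto intro: steps_Lam)
next
  case (App M1 M2)
  obtain C where "\<Gamma> \<turnstile> M1 \<^bold>: C \<rightarrow> T \<^bold>; \<Theta>" "\<Gamma> \<turnstile> M2 \<^bold>: C \<^bold>; \<Theta>"
    using App.prems(4) by (auto elim: typing_AppE)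
  with App.IH(1)[of N \<Gamma> _ \<Theta> a] App.IH(2)[of N \<Gamma> _ \<Theta> a] App.prems
  obtain W1 W2 where "substL M1 a N \<rightarrow>* W1" "core_nf W1" "\<not> is_Mu W1" "\<not> is_Lam W1"
    "substL M2 a N \<rightarrow>* W2" "core_nf W2" "\<not> is_Mu W2"
    by (metis core_nf.simps(3))
  then show ?case by (intro exI[of _ "App W1 W2"]) (auto intro: steps_App)
next
  case (Name b M)
  have M: "\<Gamma> \<turnstile> M \<^bold>: \<Theta> ! b \<^bold>; \<Theta>"
    using Name.prems(4) by (auto elim: typing_NameE)
  with Name.IH[of N \<Gamma> _ \<Theta> a] Name.prems
  obtain W where W: "substL M a N \<rightarrow>* W" "core_nf W" "\<not> is_Mu W" "is_Lam W \<longrightarrow> is_Lam M"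
    by auto
  show ?case
  proof (cases "b = a")
    case False
    with W show ?thesis by (intro exI[of _ "Name b W"]) (auto intro: steps_Name)
  next
    case True
    have "\<Gamma> \<turnstile> substL M a N \<^bold>: A \<^bold>; \<Theta>[a := B]"
      using typing_substL[OF M] Name.prems True by auto
    then have WA: "\<Gamma> \<turnstile> W \<^bold>: A \<^bold>; \<Theta>[a := B]"
      using W(1) red_typing by blast
    then obtain W1 where W1: "App N W \<rightarrow>* W1" "core_nf W1"
      using App_not_Mu_normalizes[of N W \<Gamma> A B "\<Theta>[a := B]"] Name.prems W assms by blast
    have "\<Gamma> \<turnstile> App N W \<^bold>: B \<^bold>; \<Theta>[a := B]"
      using WA Name.prems by (auto intro: ty_App)
    then have "\<Gamma> \<turnstile> Name a W1 \<^bold>: Bot \<^bold>; \<Theta>[a := B]"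
      using W1(1) red_typing Name.prems by (auto intro: ty_Name)
    \<comment> \<open>Normalizing the application may yield a \<mu>, which the name absorbs by
      \<rho>.\<close>
    from Name_normalizes[OF W1(2) this] obtain W2
      where W2: "Name a W1 \<rightarrow>* W2" "core_nf W2" "\<not> is_Mu W2" "\<not> is_Lam W2" by blast
    have "substL (Name b M) a N \<rightarrow>* Name a (App N W)"
      using W(1) True by (auto intro: steps_Name steps_AppR)
    also have "Name a (App N W) \<rightarrow>* Name a W1"
      using W1(1) by (rule steps_Name)
    finally show ?thesis using W2 by (meson rtranclp_trans)
  qed
next
  case (Mu M)
  have "\<Gamma> \<turnstile> M \<^bold>: Bot \<^bold>; T # \<Theta>"
    using Mu.prems(4) by (auto elim: typing_MuE)
  with Mu.IH[of "liftM 0 N" \<Gamma> Bot "T # \<Theta>" "Suc a"] Mu.prems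
  obtain W where "substL M (Suc a) (liftM 0 N) \<rightarrow>* W" "core_nf W" "\<not> is_Mu W"
    by (auto simp: typing_liftM_0)
  then show ?case by (intro exI[of _ "Mu W"]) (auto intro: steps_Mu)
qed

text \<open>If \<open>N\<close> is a \<mu>, then \<mu>' moves \<open>M\<close> to the names inside.
  For an abstraction \<open>M\<close>, \<open>substL_normalizes\<close> finishes. Otherwise the
  result is normal at once, and inert because each name bound by the new \<mu> carries an
  application.\<close>

lemma App_function_not_Mu_normalizes:
  assumes M: "core_nf M" "\<Gamma> \<turnstile> M \<^bold>: A \<rightarrow> B \<^bold>; \<Theta>" "\<not> is_Mu M"
    and N: "core_nf N" "\<Gamma> \<turnstile> N \<^bold>: A \<^bold>; \<Theta>"
    and A: "subst_normalizes A \<or> \<not> is_Lam M"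
  shows "\<exists>W. App M N \<rightarrow>* W \<and> core_nf W \<and>
    (\<not> is_Lam M \<longrightarrow> inert W \<and> (\<forall>c. guarded c M \<and> guarded c N \<longrightarrow> guarded c W))"
proof (cases "is_Mu N")
  case False
  show ?thesis
  proof (cases "is_Lam M")
    case True
    with App_not_Mu_normalizes[of M N \<Gamma> A B \<Theta>] assms False show ?thesis by blast
  next
    case notLam: False
    with assms False show ?thesis by (intro exI[of _ "App M N"]) auto
  qed
next
  case True
  then obtain V where V: "N = Mu V" by (cases N) auto
  have contr: "contract MuPrime (App M N) (Mu (substL V 0 (liftM 0 M)))"
    unfolding V by (rule contract.intros)
  show ?thesis
  proof (cases "is_Lam M")
    case True
    have "\<Gamma> \<turnstile> V \<^bold>: Bot \<^bold>; A # \<Theta>"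
      using N V by (auto elim: typing_MuE)
    with True substL_normalizes[of A V "liftM 0 M" \<Gamma> Bot "A # \<Theta>" 0 B] assms V
    obtain W where "substL V 0 (liftM 0 M) \<rightarrow>* W" "core_nf W" "\<not> is_Mu W"
      by (auto simp: typing_liftM_0)
    then have "App M N \<rightarrow>* Mu W" "core_nf (Mu W)"
      by (auto intro: red_contract[OF contr] steps_Mu)
    with True show ?thesis by blast
  next
    case False
    moreover have "App M N \<rightarrow>* Mu (substL V 0 (liftM 0 M))"
      by (rule red_contract[OF contr]) auto
    ultimately show ?thesis
      using assms V
      by (intro exI[of _ "Mu (substL V 0 (liftM 0 M))"])
        (auto intro: core_nf_substL guarded_substL guarded_liftM_self)
  qed
qed

text \<open>Two regimes: either \<beta>-redexes with argument type \<open>A\<close> may be fired, or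
  \<open>M\<close> is guarded and none arises. Guardedness has to survive, since the enclosing \<mu>
  may receive further arguments; \<open>guarded a N\<close> ensures this for the copies of
  \<open>N\<close>.\<close>

lemma substR_normalizes:
  "core_nf M \<Longrightarrow> core_nf N \<Longrightarrow> \<Gamma> \<turnstile> M \<^bold>: T \<^bold>; \<Theta> \<Longrightarrow> a < length \<Theta> \<Longrightarrow> \<Theta> ! a = A \<rightarrow> B \<Longrightarrow>
    \<Gamma> \<turnstile> N \<^bold>: A \<^bold>; \<Theta>[a := B] \<Longrightarrow> guarded a N \<Longrightarrow> subst_normalizes A \<or> guarded a M \<Longrightarrow>
    \<exists>W. substR M a N \<rightarrow>* W \<and> core_nf W \<and> (is_Mu W \<longrightarrow> is_Mu M) \<and> (is_Lam W \<longrightarrow> is_Lam M) \<and>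
      (guarded a M \<longrightarrow> guarded a W)"
proof (induction M arbitrary: N \<Gamma> T \<Theta> a)
  case (Var i)
  then show ?case by auto
next
  case (Lam M)
  obtain C D where "C # \<Gamma> \<turnstile> M \<^bold>: D \<^bold>; \<Theta>"
    using Lam.prems(3) by (auto elim: typing_LamE)
  with Lam.IH[of "liftL 0 N" "C # \<Gamma>" D \<Theta> a] Lam.prems
  obtain W where "substR M a (liftL 0 N) \<rightarrow>* W" "core_nf W" "guarded a M \<longrightarrow> guarded a W"
    by (auto simp: typing_liftL_0)
  then show ?case by (intro exI[of _ "Lam W"]) (auto intro: steps_Lam)
next
  case (App M1 M2)
  obtain C where C: "\<Gamma> \<turnstile> M1 \<^bold>: C \<rightarrow> T \<^bold>; \<Theta>" "\<Gamma> \<turnstile> M2 \<^bold>: C \<^bold>; \<Theta>"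
    using App.prems(3) by (auto elim: typing_AppE)
  obtain W1 where "substR M1 a N \<rightarrow>* W1" "core_nf W1" "\<not> is_Mu W1" "\<not> is_Lam W1"
    "guarded a M1 \<longrightarrow> guarded a W1"
    using App.IH(1)[of N \<Gamma> _ \<Theta> a] App.prems C by auto
  moreover obtain W2 where "substR M2 a N \<rightarrow>* W2" "core_nf W2" "\<not> is_Mu W2"
    "guarded a M2 \<longrightarrow> guarded a W2"
    using App.IH(2)[of N \<Gamma> _ \<Theta> a] App.prems C by auto
  ultimately show ?case by (intro exI[of _ "App W1 W2"]) (auto intro: steps_App)
next
  case (Name b M)
  have M: "\<Gamma> \<turnstile> M \<^bold>: \<Theta> ! b \<^bold>; \<Theta>"
    using Name.prems(3) by (auto elim: typing_NameE)
  with Name.IH[of N \<Gamma> _ \<Theta> a] Name.prems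
  obtain W where W: "substR M a N \<rightarrow>* W" "core_nf W" "\<not> is_Mu W" "is_Lam W \<longrightarrow> is_Lam M"
    "guarded a M \<longrightarrow> guarded a W"
    by auto
  show ?case
  proof (cases "b = a")
    case False
    with W show ?thesis by (intro exI[of _ "Name b W"]) (auto intro: steps_Name)
  next
    case True
    have "\<Gamma> \<turnstile> substR M a N \<^bold>: A \<rightarrow> B \<^bold>; \<Theta>[a := B]"
      using typing_substR[OF M] Name.prems True by auto
    then have WA: "\<Gamma> \<turnstile> W \<^bold>: A \<rightarrow> B \<^bold>; \<Theta>[a := B]"
      using W(1) red_typing by blast
    \<comment> \<open>In the guarded case \<open>M\<close> is not an abstraction, and by the
      induction hypothesis \<open>W\<close> is not one either.\<close>
    have "subst_normalizes A \<or> \<not> is_Lam W"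
      using Name.prems W True by auto
    from App_function_not_Mu_normalizes[OF W(2) WA W(3) Name.prems(2,6) this]
    obtain W1 where W1: "App W N \<rightarrow>* W1" "core_nf W1"
      "\<not> is_Lam W \<longrightarrow> inert W1 \<and> (guarded a W \<and> guarded a N \<longrightarrow> guarded a W1)"
      by blast
    have "\<Gamma> \<turnstile> App W N \<^bold>: B \<^bold>; \<Theta>[a := B]"
      using WA Name.prems by (auto intro: ty_App)
    then have "\<Gamma> \<turnstile> Name a W1 \<^bold>: Bot \<^bold>; \<Theta>[a := B]"
      using W1(1) red_typing Name.prems by (auto intro: ty_Name)
    from Name_normalizes[OF W1(2) this] obtain W2
      where W2: "Name a W1 \<rightarrow>* W2" "core_nf W2" "\<not> is_Mu W2" "\<not> is_Lam W2"
        "guarded a W1 \<and> inert W1 \<longrightarrow> guarded a W2" by blast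
    have "substR (Name b M) a N \<rightarrow>* Name a (App W N)"
      using W(1) True by (auto intro: steps_Name steps_AppL)
    also have "Name a (App W N) \<rightarrow>* Name a W1"
      using W1(1) by (rule steps_Name)
    also note W2(1)
    finally have "substR (Name b M) a N \<rightarrow>* W2" .
    moreover have "guarded a (Name b M) \<longrightarrow> guarded a W2"
      using W W1(3) W2(5) True Name.prems by auto
    ultimately show ?thesis using W2(2-4) by blast
  qed
next
  case (Mu M)
  have "\<Gamma> \<turnstile> M \<^bold>: Bot \<^bold>; T # \<Theta>"
    using Mu.prems(3) by (auto elim: typing_MuE)
  with Mu.IH[of "liftM 0 N" \<Gamma> Bot "T # \<Theta>" "Suc a"] Mu.prems
  obtain W where "substR M (Suc a) (liftM 0 N) \<rightarrow>* W" "core_nf W" "\<not> is_Mu W"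
    "guarded (Suc a) M \<longrightarrow> guarded (Suc a) W"
    by (auto simp: typing_liftM_0)
  then show ?case by (intro exI[of _ "Mu W"]) (auto intro: steps_Mu)
qed

text \<open>If \<open>M\<close> is a \<mu>, it is distributed first even when \<open>N\<close> is a
  \<mu> too; \<mu>' then acts at the names, where the function is not a \<mu>. Inertness is passed
  on so that it lasts along a chain of arguments.\<close>

lemma App_normalizes:
  assumes M: "core_nf M" "\<Gamma> \<turnstile> M \<^bold>: A \<rightarrow> B \<^bold>; \<Theta>"
    and N: "core_nf N" "\<Gamma> \<turnstile> N \<^bold>: A \<^bold>; \<Theta>"
    and A: "subst_normalizes A \<or> inert M"
  shows "\<exists>W. App M N \<rightarrow>* W \<and> core_nf W \<and> (inert M \<longrightarrow> inert W)"
proof (cases "is_Mu M")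
  case False
  then show ?thesis
    using App_function_not_Mu_normalizes[OF M False N] A inert_not_Mu by blast
next
  case True
  then obtain V where V: "M = Mu V" by (cases M) auto
  have "\<Gamma> \<turnstile> V \<^bold>: Bot \<^bold>; (A \<rightarrow> B) # \<Theta>"
    using M V by (auto elim: typing_MuE)
  \<comment> \<open>The lifted \<open>N\<close> has no name 0, so it is guarded for it.\<close>
  with substR_normalizes[of V "liftM 0 N" \<Gamma> Bot "(A \<rightarrow> B) # \<Theta>" 0 A B] assms V
  obtain W where W: "substR V 0 (liftM 0 N) \<rightarrow>* W" "core_nf W" "\<not> is_Mu W"
    "guarded 0 V \<longrightarrow> guarded 0 W"
    by (auto simp: typing_liftM_0 guarded_liftM_self)
  have "App M N \<rightarrow>* Mu W"
    unfolding V using contract.intros(2) _ steps_Mu[OF W(1)] by (rule red_contract) simp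
  with W V show ?thesis by (intro exI[of _ "Mu W"]) auto
qed

section \<open>Substitution into normal terms and core normalization\<close>

primrec headed :: "nat \<Rightarrow> trm \<Rightarrow> bool" where
  "headed k (Var i) = (i = k)"
| "headed k (Lam M) = False"
| "headed k (App M N) = headed k M"
| "headed k (Name a M) = False"
| "headed k (Mu M) = False"

text \<open>Each argument on the spine strips one arrow from the type of \<open>k\<close>. So if a
  headed term has type \<open>C \<rightarrow> T\<close>, then \<open>C\<close> is strictly smaller
  than the type of \<open>k\<close>.\<close>

lemma headed_size_le:
  "\<Gamma> \<turnstile> M \<^bold>: T \<^bold>; \<Theta> \<Longrightarrow> headed k M \<Longrightarrow> size T \<le> size (\<Gamma> ! k)"
  by (induction rule: typing.induct) auto

text \<open>Induction on \<open>M\<close> with \<open>A\<close> fixed; \<open>\<Gamma>1\<close>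
  collects the \<lambda>-binders crossed. The last conjunct serves function parts not headed by the
  substituted variable, whose argument type may be larger than \<open>A\<close>.\<close>

lemma subst_normalizes_step:
  assumes smaller: "\<And>C. size C < size A \<Longrightarrow> subst_normalizes C"
  shows "core_nf M \<Longrightarrow> core_nf N \<Longrightarrow> \<Gamma>1 @ A # \<Gamma>2 \<turnstile> M \<^bold>: T \<^bold>; \<Theta> \<Longrightarrow> \<Gamma>1 @ \<Gamma>2 \<turnstile> N \<^bold>: A \<^bold>; \<Theta> \<Longrightarrow>
    \<exists>W. subst M (length \<Gamma>1) N \<rightarrow>* W \<and> core_nf W \<and>
      (\<not> headed (length \<Gamma>1) M \<and> \<not> is_Lam M \<and> \<not> is_Mu M \<longrightarrow> inert W)"
proof (induction M arbitrary: N \<Gamma>1 T \<Theta>)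
  case (Var i)
  then show ?case by auto
next
  case (Lam M)
  obtain C D where "C # \<Gamma>1 @ A # \<Gamma>2 \<turnstile> M \<^bold>: D \<^bold>; \<Theta>"
    using Lam.prems(3) by (auto elim: typing_LamE)
  with Lam.IH[of "liftL 0 N" "C # \<Gamma>1" D \<Theta>] Lam.prems
  obtain W where "subst M (Suc (length \<Gamma>1)) (liftL 0 N) \<rightarrow>* W" "core_nf W"
    by (auto simp: typing_liftL_0)
  then show ?case by (intro exI[of _ "Lam W"]) (auto intro: steps_Lam)
next
  case (App M1 M2)
  let ?k = "length \<Gamma>1"
  obtain C where C: "\<Gamma>1 @ A # \<Gamma>2 \<turnstile> M1 \<^bold>: C \<rightarrow> T \<^bold>; \<Theta>" "\<Gamma>1 @ A # \<Gamma>2 \<turnstile> M2 \<^bold>: C \<^bold>; \<Theta>"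
    using App.prems(3) by (auto elim: typing_AppE)
  \<comment> \<open>Since \<open>App M1 M2\<close> is normal, \<open>M1\<close> is neither an
    abstraction nor a \<mu>, so being headed decides about inertness.\<close>
  obtain W1 where W1: "subst M1 ?k N \<rightarrow>* W1" "core_nf W1" "\<not> headed ?k M1 \<longrightarrow> inert W1"
    using App.IH(1)[of N \<Gamma>1] App.prems C by auto
  obtain W2 where W2: "subst M2 ?k N \<rightarrow>* W2" "core_nf W2"
    using App.IH(2)[of N \<Gamma>1] App.prems C by auto
  have "\<Gamma>1 @ \<Gamma>2 \<turnstile> W1 \<^bold>: C \<rightarrow> T \<^bold>; \<Theta>" "\<Gamma>1 @ \<Gamma>2 \<turnstile> W2 \<^bold>: C \<^bold>; \<Theta>"
    using C W1(1) W2(1) App.prems(4) by (auto intro: red_typing typing_subst)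
  moreover have "subst_normalizes C \<or> inert W1"
  proof (cases "headed ?k M1")
    case True
    with headed_size_le[OF C(1)] smaller show ?thesis by fastforce
  next
    case False
    with W1 show ?thesis by blast
  qed
  ultimately obtain W where W: "App W1 W2 \<rightarrow>* W" "core_nf W" "inert W1 \<longrightarrow> inert W"
    using App_normalizes W1(2) W2(2) by blast
  have "subst (App M1 M2) ?k N \<rightarrow>* App W1 W2"
    using W1 W2 by (auto intro: steps_App)
  also note W(1)
  finally show ?case using W W1 by auto
next
  case (Name a M)
  have M: "\<Gamma>1 @ A # \<Gamma>2 \<turnstile> M \<^bold>: \<Theta> ! a \<^bold>; \<Theta>" "a < length \<Theta>"
    using Name.prems(3) by (auto elim: typing_NameE)
  with Name.IH[of N \<Gamma>1] Name.prems obtain W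
    where W: "subst M (length \<Gamma>1) N \<rightarrow>* W" "core_nf W" by auto
  then have "\<Gamma>1 @ \<Gamma>2 \<turnstile> Name a W \<^bold>: Bot \<^bold>; \<Theta>"
    using M Name.prems(4) by (auto intro!: ty_Name intro: red_typing typing_subst)
  from Name_normalizes[OF W(2) this] obtain W'
    where W': "Name a W \<rightarrow>* W'" "core_nf W'" "\<not> is_Mu W'" "\<not> is_Lam W'" by blast
  have "subst (Name a M) (length \<Gamma>1) N \<rightarrow>* Name a W"
    using W by (auto intro: steps_Name)
  also note W'(1)
  finally show ?case using W' inert_not_Mu by blast
next
  case (Mu M)
  have M: "\<Gamma>1 @ A # \<Gamma>2 \<turnstile> M \<^bold>: Bot \<^bold>; T # \<Theta>"
    using Mu.prems(3) by (auto elim: typing_MuE)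
  with Mu.IH[OF _ _ M typing_liftM_0] Mu.prems obtain W
    where W: "subst M (length \<Gamma>1) (liftM 0 N) \<rightarrow>* W" "core_nf W"
    by auto
  then have "\<Gamma>1 @ \<Gamma>2 \<turnstile> Mu W \<^bold>: T \<^bold>; \<Theta>"
    using M Mu.prems(4) by (auto intro!: ty_Mu intro: red_typing typing_subst typing_liftM_0)
  from Mu_normalizes[OF W(2) this] obtain W'
    where W': "Mu W \<rightarrow>* Mu W'" "core_nf (Mu W')" by blast
  have "subst (Mu M) (length \<Gamma>1) N \<rightarrow>* Mu W"
    using W by (auto intro: steps_Mu)
  also note W'(1)
  finally show ?case using W' by auto
qed

lemma subst_normalizes: "subst_normalizes A"
proof (induction "size A" arbitrary: A rule: less_induct)
  case less
  show ?case
    unfolding subst_normalizes_def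
    using subst_normalizes_step[OF less, of A _ _ "[]"] by fastforce
qed

text \<open>Immediate subterms are normalized first, which leaves redexes only at the root. At an
  application, \<open>subst_normalizes\<close> is now available for every argument type.\<close>

lemma typing_core_nf: "\<Gamma> \<turnstile> M \<^bold>: T \<^bold>; \<Theta> \<Longrightarrow> \<exists>W. M \<rightarrow>* W \<and> core_nf W"
proof (induction rule: typing.induct)
  case (ty_Var i \<Gamma> A \<Theta>)
  then show ?case by (intro exI[of _ "Var i"]) auto
next
  case (ty_Lam A \<Gamma> M B \<Theta>)
  then obtain W where "M \<rightarrow>* W" "core_nf W" by blast
  then show ?case by (intro exI[of _ "Lam W"]) (auto intro: steps_Lam)
next
  case (ty_App \<Gamma> M A B \<Theta> N)
  then obtain V W where VW: "M \<rightarrow>* V" "core_nf V" "N \<rightarrow>* W" "core_nf W" by blast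
  then obtain W' where "App V W \<rightarrow>* W'" "core_nf W'"
    using App_normalizes[of V \<Gamma> A B \<Theta> W] ty_App.hyps subst_normalizes red_typing by blast
  then show ?case using steps_App[OF VW(1,3)] rtranclp_trans by fastforce
next
  case (ty_Name a \<Theta> A \<Gamma> M)
  then obtain W where W: "M \<rightarrow>* W" "core_nf W" by blast
  then have "\<Gamma> \<turnstile> Name a W \<^bold>: Bot \<^bold>; \<Theta>"
    using ty_Name.hyps by (auto intro: typing.ty_Name red_typing)
  from Name_normalizes[OF W(2) this] steps_Name[OF W(1)] show ?case
    using rtranclp_trans by fastforce
next
  case (ty_Mu \<Gamma> M A \<Theta>)
  then obtain W where W: "M \<rightarrow>* W" "core_nf W" by blast
  then have "\<Gamma> \<turnstile> Mu W \<^bold>: A \<^bold>; \<Theta>"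
    using ty_Mu.hyps by (auto intro: typing.ty_Mu red_typing)
  from Mu_normalizes[OF W(2) this] steps_Mu[OF W(1)] show ?case
    using rtranclp_trans by fastforce
qed

section \<open>Postponed \<theta>-steps\<close>

primrec theta_nf :: "trm \<Rightarrow> bool" where
  "theta_nf (Var i) = True"
| "theta_nf (Lam M) = theta_nf M"
| "theta_nf (App M N) = (theta_nf M \<and> theta_nf N)"
| "theta_nf (Name a M) = theta_nf M"
| "theta_nf (Mu M) = (theta_nf M \<and> (\<forall>P. M = Name 0 P \<longrightarrow> freeM 0 P))"

lemma freeM_liftM: "k \<le> a \<Longrightarrow> freeM (Suc a) (liftM k M) = freeM a M"
  "a < k \<Longrightarrow> freeM a (liftM k M) = freeM a M"
  by (induction M arbitrary: a k) auto

text \<open>Used for a lowered term, which lifting takes back to the body of the \<theta>-redex; the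
  contractum thus inherits normality from that body.\<close>

lemma theta_nf_liftM: "theta_nf (liftM k M) \<Longrightarrow> theta_nf M"
  by (induction M arbitrary: k) (auto simp: freeM_liftM)

text \<open>A \<theta>-step may expose an abstraction in place of a \<mu>. No redex results, because
  in a core normal term a \<mu> is never a function, an argument, or directly below a name or a
  \<mu>. The last conjunct says that terms of other shapes become neither a \<mu> nor a new
  abstraction.\<close>

lemma theta_normalizes:
  "core_nf M \<Longrightarrow> \<exists>W. (step {Theta})\<^sup>*\<^sup>* M W \<and> core_nf W \<and> theta_nf W \<and>
    (\<not> is_Mu M \<longrightarrow> \<not> is_Mu W \<and> (is_Lam W \<longrightarrow> is_Lam M))"
proof (induction M)
  case (Var i)
  then show ?case by (intro exI[of _ "Var i"]) auto
next
  case (Lam M)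
  then obtain W where "(step {Theta})\<^sup>*\<^sup>* M W" "core_nf W" "theta_nf W" by auto
  then show ?case by (intro exI[of _ "Lam W"]) (auto intro: steps_Lam)
next
  case (App M1 M2)
  obtain W1 where "(step {Theta})\<^sup>*\<^sup>* M1 W1" "core_nf W1" "theta_nf W1" "\<not> is_Mu W1" "\<not> is_Lam W1"
    using App by auto
  moreover obtain W2 where "(step {Theta})\<^sup>*\<^sup>* M2 W2" "core_nf W2" "theta_nf W2" "\<not> is_Mu W2"
    using App by auto
  ultimately show ?case by (intro exI[of _ "App W1 W2"]) (auto intro: steps_App)
next
  case (Name a M)
  then obtain W where "(step {Theta})\<^sup>*\<^sup>* M W" "core_nf W" "theta_nf W" "\<not> is_Mu W" by auto
  then show ?case by (intro exI[of _ "Name a W"]) (auto intro: steps_Name)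
next
  case (Mu M)
  then obtain W where W: "(step {Theta})\<^sup>*\<^sup>* M W" "core_nf W" "theta_nf W" "\<not> is_Mu W" by auto
  show ?case
  proof (cases "theta_nf (Mu W)")
    case True
    with W show ?thesis by (intro exI[of _ "Mu W"]) (auto intro: steps_Mu)
  next
    case False
    \<comment> \<open>As \<open>W\<close> is already \<theta>-normal, the only possible
      \<theta>-redex is at the root.\<close>
    then obtain P where P: "W = Name 0 P" "\<not> freeM 0 P" using W by auto
    from P(2) have lift: "liftM 0 (lowerM 0 P) = P" by (rule liftM_lowerM)
    have "(step {Theta})\<^sup>*\<^sup>* (Mu M) (Mu W)" using W(1) by (rule steps_Mu)
    also have "step {Theta} (Mu W) (lowerM 0 P)"
      using P by (auto intro: step_redex contract.intros)
    finally show ?thesis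
      using W P(1) core_nf_liftM[of 0 "lowerM 0 P"] theta_nf_liftM[of 0 "lowerM 0 P"] lift
      by auto
  qed
qed

text \<open>Both predicates pass to subterms, and together they exclude the redexes of all six
  rules, whence an arbitrary \<open>R\<close>.\<close>

lemma normal_if_core_theta_nf:
  assumes "core_nf M" "theta_nf M"
  shows "normal R M"
proof -
  have "core_nf P \<and> theta_nf P" if "P \<in> subterms M" for P
    using that assms by (induction M) auto
  then show ?thesis
    unfolding normal_def by (fastforce elim: contract.cases)
qed

lemma step_mono: "step R M N \<Longrightarrow> R \<subseteq> S \<Longrightarrow> step S M N"
  by (induction rule: step.induct) (auto intro: step.intros)

theorem theorem5p20:
  fixes M :: trm
  assumes "M \<in> typable"
  shows "M \<in> WN {Beta, MuRule, MuPrime, Rho, Epsilon, Theta}"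
proof -
  let ?R = "{Beta, MuRule, MuPrime, Rho, Epsilon, Theta}"
  obtain W where W: "M \<rightarrow>* W" "core_nf W"
    using assms typing_core_nf unfolding typable_def by blast
  obtain W' where W': "(step {Theta})\<^sup>*\<^sup>* W W'" "core_nf W'" "theta_nf W'"
    using theta_normalizes[OF W(2)] by blast
  have "(step ?R)\<^sup>*\<^sup>* M W"
    using W(1) by (rule rtranclp_mono[THEN predicate2D, rotated]) (auto intro: step_mono)
  also have "(step ?R)\<^sup>*\<^sup>* W W'"
    using W'(1) by (rule rtranclp_mono[THEN predicate2D, rotated]) (auto intro: step_mono)
  finally show ?thesis
    unfolding WN_def using normal_if_core_theta_nf[OF W'(2,3)] by blast
qed

end
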